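(* Assume that $T$ is continuous on $C$, that $S_*\neq\varnothing$ and that $S_*\subseteq S_{\rm dual}$. Let $(x^k)_{k\in\mathbb{N}}$ be an infinite sequence generated by Conceptual Algorithm F with Variant F.2, that is, $x^{k+1}=P_{C\cap H(\overline{x}^k,\bar v^k)}(x^k)$, such that $x^k\notin S_*$ for all $k\in\mathbb{N}$. Then $(x^k)_{k\in\mathbb{N}}$ converges to a point in $S_*$.
   Context: $\mathbb{R}^n$ carries the Euclidean inner product $\langle\cdot,\cdot\rangle$ and norm $\|\cdot\|$; $\mathbb{N}=\{0,1,2,\dots\}$. $T:\operatorname{dom}(T)\subseteq\mathbb{R}^n\to\mathbb{R}^n$ is an operator and $C\subseteq\operatorname{dom}(T)$ is nonempty, closed and convex. $P_S$ is the orthogonal projection onto a nonempty closed convex set $S$. For $x\in C$, $\mathcal{N}_C(x)=\{u\in\mathbb{R}^n:\langle u,y-x\rangle\le 0\ \forall y\in C\}$. $S_*=\{x_*\in C:\langle T(x_* ),x-x_*\rangle\ge0\ \forall x\in C\}$ and $S_{\rm dual}=\{x_*\in C:\langle T(x),x-x_*\rangle\ge0\ \forall x\in C\}$. For $z\in C$ and $v\in\mathcal{N}_C(z)$, $H(z,v)=\{y\in\mathbb{R}^n:\langle T(z)+v,y-z\rangle\le0\}$. Conceptual Algorithm F. Fix $(\beta_k)_{k\in\mathbb{N}}\subset[\check\beta,\hat\beta]$ with $0<\check\beta\le\hat\beta<+\infty$, $\delta,\theta\in(0,1)$, $M>0$. Linesearch F, for input $x\in C$, $u\in\mathcal{N}_C(x)$,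 $\beta>0$: start with $\alpha=1$. For each trial $\alpha$ let $z_\alpha=P_C(x-\beta(T(x)+\alpha u))$ and choose any $v_\alpha\in\mathcal{N}_C(\alpha z_\alpha+(1-\alpha)x)$ with $\|v_\alpha\|\le M$. While $\langle T(\alpha z_\alpha+(1-\alpha)x)+v_\alpha,\,x-z_\alpha\rangle<\delta\langle T(x)+\alpha u,\,x-z_\alpha\rangle$, replace $\alpha$ by $\theta\alpha$ (and choose a new such $v_\alpha$). Output $(\alpha,z_\alpha,v_\alpha)$. Algorithm: take $x^0\in C$. At iteration $k$, stop if $x^k=P_C(x^k-T(x^k))$. Otherwise choose any $u^k\in\mathcal{N}_C(x^k)$ with $\|u^k\|\le M$, let $(\alpha_k,z^k,\bar v^k)$ be the output of Linesearch F for input $(x^k,u^k,\beta_k)$, set $\overline{x}^k=\alpha_kz^k+(1-\alpha_k)x^k$, and compute $x^{k+1}$ by the update rule of the chosen variant. *)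

theory Defs
  imports "HOL-Analysis.Analysis"
begin

text \<open>
  The operator \<open>T\<close> is a total function here; nothing below depends on its values
  outside \<open>C\<close>.  The orthogonal projection \<open>P\<^sub>S(x)\<close> is the library's
  \<open>closest_point S x\<close>, which is meaningful for nonempty closed (convex) \<open>S\<close>.
\<close>

definition normal_cone :: "(real ^ 'n) set \<Rightarrow> real ^ 'n \<Rightarrow> (real ^ 'n) set" where
  "normal_cone C x = {u. \<forall>y\<in>C. u \<bullet> (y - x) \<le> 0}"

definition VI_solutions :: "(real ^ 'n \<Rightarrow> real ^ 'n) \<Rightarrow> (real ^ 'n) set \<Rightarrow> (real ^ 'n) set" where
  "VI_solutions T C = {xs \<in> C. \<forall>x\<in>C. T xs \<bullet> (x - xs) \<ge> 0}"

definition dual_VI_solutions :: "(real ^ 'n \<Rightarrow> real ^ 'n) \<Rightarrow> (real ^ 'n) set \<Rightarrow> (real ^ 'n) set" where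
  "dual_VI_solutions T C = {xs \<in> C. \<forall>x\<in>C. T x \<bullet> (x - xs) \<ge> 0}"

definition sep_halfspace :: "(real ^ 'n \<Rightarrow> real ^ 'n) \<Rightarrow> real ^ 'n \<Rightarrow> real ^ 'n \<Rightarrow> (real ^ 'n) set" where
  "sep_halfspace T z v = {y. (T z + v) \<bullet> (y - z) \<le> 0}"

definition trial_z ::
  "(real ^ 'n \<Rightarrow> real ^ 'n) \<Rightarrow> (real ^ 'n) set \<Rightarrow> real ^ 'n \<Rightarrow> real ^ 'n \<Rightarrow> real \<Rightarrow> real \<Rightarrow> real ^ 'n" where
  "trial_z T C x u \<beta> \<alpha> = closest_point C (x - \<beta> *\<^sub>R (T x + \<alpha> *\<^sub>R u))"

definition trial_point ::
  "(real ^ 'n \<Rightarrow> real ^ 'n) \<Rightarrow> (real ^ 'n) set \<Rightarrow> real ^ 'n \<Rightarrow> real ^ 'n \<Rightarrow> real \<Rightarrow> real \<Rightarrow> real ^ 'n" where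
  "trial_point T C x u \<beta> \<alpha> = \<alpha> *\<^sub>R trial_z T C x u \<beta> \<alpha> + (1 - \<alpha>) *\<^sub>R x"

definition backtrack ::
  "(real ^ 'n \<Rightarrow> real ^ 'n) \<Rightarrow> (real ^ 'n) set \<Rightarrow> real \<Rightarrow> real ^ 'n \<Rightarrow> real ^ 'n \<Rightarrow> real
     \<Rightarrow> real \<Rightarrow> real ^ 'n \<Rightarrow> bool" where
  "backtrack T C \<delta> x u \<beta> \<alpha> v \<longleftrightarrow>
     (T (trial_point T C x u \<beta> \<alpha>) + v) \<bullet> (x - trial_z T C x u \<beta> \<alpha>)
       < \<delta> * ((T x + \<alpha> *\<^sub>R u) \<bullet> (x - trial_z T C x u \<beta> \<alpha>))"

text \<open>
  The pairs \<open>(\<alpha>, v\<^sub>\<alpha>)\<close> that some run of the linesearch reaches at its loop head.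
  The choice of \<open>v\<^sub>\<alpha>\<close> is free at each trial, so this is a relation and not a function.
\<close>

inductive linesearch_F_reaches ::
  "(real ^ 'n \<Rightarrow> real ^ 'n) \<Rightarrow> (real ^ 'n) set \<Rightarrow> real \<Rightarrow> real \<Rightarrow> real
     \<Rightarrow> real ^ 'n \<Rightarrow> real ^ 'n \<Rightarrow> real \<Rightarrow> real \<Rightarrow> real ^ 'n \<Rightarrow> bool"
  for T C \<delta> \<theta> M x u \<beta> where
  start: "\<lbrakk>v \<in> normal_cone C (trial_point T C x u \<beta> 1); norm v \<le> M\<rbrakk>
    \<Longrightarrow> linesearch_F_reaches T C \<delta> \<theta> M x u \<beta> 1 v"
| step: "\<lbrakk>linesearch_F_reaches T C \<delta> \<theta> M x u \<beta> \<alpha> v;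
      backtrack T C \<delta> x u \<beta> \<alpha> v;
      v' \<in> normal_cone C (trial_point T C x u \<beta> (\<theta> * \<alpha>)); norm v' \<le> M\<rbrakk>
    \<Longrightarrow> linesearch_F_reaches T C \<delta> \<theta> M x u \<beta> (\<theta> * \<alpha>) v'"

definition linesearch_F_output ::
  "(real ^ 'n \<Rightarrow> real ^ 'n) \<Rightarrow> (real ^ 'n) set \<Rightarrow> real \<Rightarrow> real \<Rightarrow> real
     \<Rightarrow> real ^ 'n \<Rightarrow> real ^ 'n \<Rightarrow> real \<Rightarrow> real \<Rightarrow> real ^ 'n \<Rightarrow> real ^ 'n \<Rightarrow> bool" where
  "linesearch_F_output T C \<delta> \<theta> M x u \<beta> \<alpha> z v \<longleftrightarrow>
     linesearch_F_reaches T C \<delta> \<theta> M x u \<beta> \<alpha> v \<and>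
     \<not> backtrack T C \<delta> x u \<beta> \<alpha> v \<and>
     z = trial_z T C x u \<beta> \<alpha>"

text \<open>
  An infinite run of Conceptual Algorithm F, recording all its iterates and choices;
  the update rule is a parameter:
  \<open>update a b v\<close> is the next iterate for \<open>a = x\<^sup>k\<close>, \<open>b = \<alpha>\<^sub>k z\<^sup>k + (1 - \<alpha>\<^sub>k) x\<^sup>k\<close>
  and \<open>v\<close> the vector returned by the linesearch.  As the run is infinite, the
  stopping test fails at every iteration.
\<close>

definition conceptual_algorithm_F ::
  "(real ^ 'n \<Rightarrow> real ^ 'n) \<Rightarrow> (real ^ 'n) set \<Rightarrow> (nat \<Rightarrow> real) \<Rightarrow> real \<Rightarrow> real \<Rightarrow> real
     \<Rightarrow> (real ^ 'n \<Rightarrow> real ^ 'n \<Rightarrow> real ^ 'n \<Rightarrow> real ^ 'n)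
     \<Rightarrow> (nat \<Rightarrow> real ^ 'n) \<Rightarrow> (nat \<Rightarrow> real ^ 'n) \<Rightarrow> (nat \<Rightarrow> real)
     \<Rightarrow> (nat \<Rightarrow> real ^ 'n) \<Rightarrow> (nat \<Rightarrow> real ^ 'n) \<Rightarrow> bool" where
  "conceptual_algorithm_F T C \<beta> \<delta> \<theta> M update x u \<alpha> z v \<longleftrightarrow>
     x 0 \<in> C \<and>
     (\<forall>k. x k \<noteq> closest_point C (x k - T (x k)) \<and>
          u k \<in> normal_cone C (x k) \<and> norm (u k) \<le> M \<and>
          linesearch_F_output T C \<delta> \<theta> M (x k) (u k) (\<beta> k) (\<alpha> k) (z k) (v k) \<and>
          x (Suc k) = update (x k) (\<alpha> k *\<^sub>R z k + (1 - \<alpha> k) *\<^sub>R x k) (v k))"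

definition variant_F2 ::
  "(real ^ 'n \<Rightarrow> real ^ 'n) \<Rightarrow> (real ^ 'n) set
     \<Rightarrow> real ^ 'n \<Rightarrow> real ^ 'n \<Rightarrow> real ^ 'n \<Rightarrow> real ^ 'n" where
  "variant_F2 T C x xbar v = closest_point (C \<inter> sep_halfspace T xbar v) x"

end

theory Submission
  imports Defs
begin

text \<open>
  Every solution of the variational inequality lies in all the separating halfspaces, so the
  iterates are Fejer monotone with respect to the solution set and consecutive iterates approach
  each other; with the linesearch inequality this gives
  \<open>\<alpha>\<^sub>k \<parallel>x\<^sup>k - z\<^sup>k\<parallel>\<^sup>2 \<longrightarrow> 0\<close>.  Pass to a subsequence along which everything converges.
  If the stepsizes stay away from zero, the limit of \<open>x\<^sup>k\<close> is a fixed point of the projection step,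
  hence a solution.  If they tend to zero, the rejected trial stepsize \<open>\<alpha>\<^sub>k / \<theta>\<close> tends to
  zero as well, and passing to the limit in the rejection inequality gives a fixed point again.
  A Fejer monotone sequence with a cluster point in the target set converges to it.
\<close>

section \<open>Normal cones and projected trial points\<close>

lemma normal_cone_limit:
  fixes x u :: "nat \<Rightarrow> real ^ 'n"
  assumes "\<And>k. u k \<in> normal_cone C (x k)" and "x \<longlonglongrightarrow> x'" and "u \<longlonglongrightarrow> u'"
  shows "u' \<in> normal_cone C x'"
  unfolding normal_cone_def
proof (safe)
  fix y assume y: "y \<in> C"
  have "(\<lambda>k. u k \<bullet> (y - x k)) \<longlonglongrightarrow> u' \<bullet> (y - x')"
    by (intro tendsto_intros assms)
  moreover have "u k \<bullet> (y - x k) \<le> 0" for k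
    using assms(1)[of k] y by (auto simp: normal_cone_def)
  ultimately show "u' \<bullet> (y - x') \<le> 0"
    by (intro LIMSEQ_le_const2) auto
qed

lemma trial_z_in:
  assumes "closed C" "C \<noteq> {}"
  shows "trial_z T C x u b a \<in> C"
  unfolding trial_z_def by (rule closest_point_in_set[OF assms])

lemma trial_point_in:
  assumes "closed C" "convex C" "x \<in> C" "0 \<le> a" "a \<le> 1"
  shows "trial_point T C x u b a \<in> C"
proof -
  have "C \<noteq> {}" using assms by auto
  then show ?thesis
    unfolding trial_point_def
    using convexD[OF \<open>convex C\<close> trial_z_in[OF \<open>closed C\<close>] \<open>x \<in> C\<close>] assms by simp
qed

text \<open>Test the variational inequality of the projection at the point \<open>x\<close>, which
  itself lies in \<open>C\<close>.\<close>

lemma trial_z_decrease: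
  assumes "closed C" "convex C" "x \<in> C"
  shows "(norm (x - trial_z T C x u b a))\<^sup>2 \<le> b * ((T x + a *\<^sub>R u) \<bullet> (x - trial_z T C x u b a))"
proof -
  define p where "p = x - trial_z T C x u b a"
  define w where "w = T x + a *\<^sub>R u"
  have "(x - b *\<^sub>R w - trial_z T C x u b a) \<bullet> p \<le> 0"
    using closest_point_dot[OF assms(2,1,3)] unfolding trial_z_def w_def p_def .
  then have "(p - b *\<^sub>R w) \<bullet> p \<le> 0"
    by (simp add: p_def algebra_simps)
  then show ?thesis
    unfolding p_def[symmetric] w_def[symmetric]
    by (simp add: inner_diff_left power2_norm_eq_inner)
qed

text \<open>As \<open>x\<close> is its own projection, this is nonexpansiveness of the projection.
  It keeps the points \<open>z k\<close> of a run bounded.\<close>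

lemma norm_trial_z_diff_le:
  assumes "closed C" "convex C" "x \<in> C" "0 \<le> b"
  shows "norm (trial_z T C x u b a - x) \<le> b * norm (T x + a *\<^sub>R u)"
proof -
  have "C \<noteq> {}" using assms by auto
  then have "dist (trial_z T C x u b a) (closest_point C x) \<le> dist (x - b *\<^sub>R (T x + a *\<^sub>R u)) x"
    unfolding trial_z_def by (rule closest_point_lipschitz[OF assms(2,1)])
  then show ?thesis
    using assms by (simp add: closest_point_self dist_norm)
qed

text \<open>At a fixed point the projection inequality makes \<open>T x + a *\<^sub>R u\<close>
  nonnegative against \<open>y - x\<close>. The share of \<open>u\<close> in this is nonpositive, so
  the share of \<open>T x\<close> alone must be nonnegative.\<close>

lemma trial_z_fixed_point_VI:
  assumes "closed C" "convex C" "x \<in> C" "0 < b" "0 \<le> a" "u \<in> normal_cone C x"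
    and "trial_z T C x u b a = x"
  shows "x \<in> VI_solutions T C"
  unfolding VI_solutions_def
proof (safe)
  fix y assume y: "y \<in> C"
  have "(x - b *\<^sub>R (T x + a *\<^sub>R u) - x) \<bullet> (y - x) \<le> 0"
    using closest_point_dot[OF assms(2,1) y, of "x - b *\<^sub>R (T x + a *\<^sub>R u)"] assms(7)
    unfolding trial_z_def by simp
  then have "0 \<le> b * ((T x + a *\<^sub>R u) \<bullet> (y - x))"
    by (simp add: inner_diff_left)
  then have "0 \<le> T x \<bullet> (y - x) + a * (u \<bullet> (y - x))"
    using \<open>0 < b\<close> by (simp add: zero_le_mult_iff inner_add_left)
  moreover have "a * (u \<bullet> (y - x)) \<le> 0"
    using assms(5,6) y by (auto simp: normal_cone_def mult_nonneg_nonpos)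
  ultimately show "0 \<le> T x \<bullet> (y - x)" by linarith
qed (fact assms(3))

text \<open>Continuity of \<open>T\<close> on \<open>C\<close> and of the projection, jointly in all
  four arguments, since point, normal, \<open>b\<close> and \<open>a\<close> all vary along the
  subsequence.\<close>

lemma tendsto_trial_z:
  assumes "closed C" "convex C" "continuous_on C T" "\<And>k. x k \<in> C"
    and "x \<longlonglongrightarrow> x'" "u \<longlonglongrightarrow> u'" "b \<longlonglongrightarrow> b'" "a \<longlonglongrightarrow> a'"
  shows "(\<lambda>k. trial_z T C (x k) (u k) (b k) (a k)) \<longlonglongrightarrow> trial_z T C x' u' b' a'"
proof -
  have "C \<noteq> {}" "x' \<in> C"
    using assms(4) closed_sequentially[OF assms(1) _ assms(5)] by auto
  have "(\<lambda>k. T (x k)) \<longlonglongrightarrow> T x'"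
    by (rule continuous_on_tendsto_compose[OF assms(3,5) \<open>x' \<in> C\<close>]) (simp add: assms(4))
  then have "(\<lambda>k. x k - b k *\<^sub>R (T (x k) + a k *\<^sub>R u k)) \<longlonglongrightarrow> x' - b' *\<^sub>R (T x' + a' *\<^sub>R u')"
    by (intro tendsto_intros assms)
  then show ?thesis
    unfolding trial_z_def
    by (rule isCont_tendsto_compose[OF continuous_at_closest_point[OF assms(2,1) \<open>C \<noteq> {}\<close>]])
qed

section \<open>Invariants of the linesearch\<close>

lemma linesearch_F_reaches_bounds:
  assumes "linesearch_F_reaches T C \<delta> \<theta> M x u \<beta> \<alpha> v" and "\<theta> \<in> {0<..<1}"
  shows "0 < \<alpha> \<and> \<alpha> \<le> 1 \<and> v \<in> normal_cone C (trial_point T C x u \<beta> \<alpha>) \<and> norm v \<le> M"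
  using assms(1)
proof (induction rule: linesearch_F_reaches.induct)
  case (step \<alpha> v v')
  then show ?case
    using assms(2) by (auto intro: mult_le_one)
qed auto

text \<open>A stepsize below 1 can only arise from the rule \<open>step\<close>, so its predecessor
  failed the test, with a normal vector \<open>w\<close> of its own that may differ from
  \<open>v\<close>.\<close>

lemma linesearch_F_reaches_rejected:
  assumes "linesearch_F_reaches T C \<delta> \<theta> M x u \<beta> \<alpha> v" and "\<theta> \<in> {0<..<1}" and "\<alpha> < 1"
  shows "\<exists>w. w \<in> normal_cone C (trial_point T C x u \<beta> (\<alpha> / \<theta>)) \<and> norm w \<le> M
    \<and> \<alpha> / \<theta> \<le> 1 \<and> backtrack T C \<delta> x u \<beta> (\<alpha> / \<theta>) w"
  using assms(1)
proof cases
  case start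
  then show ?thesis using assms(3) by simp
next
  case (step a w)
  moreover have "\<alpha> / \<theta> = a" using step assms(2) by simp
  ultimately show ?thesis
    using linesearch_F_reaches_bounds[OF step(2) assms(2)] by auto
qed

section \<open>Compactness, projections and monotone distances\<close>

lemma bounded_image_continuous_closed:
  fixes T :: "'a::heine_borel \<Rightarrow> 'b::metric_space"
  assumes "continuous_on C T" "closed C" "S \<subseteq> C" "bounded S"
  shows "bounded (T ` S)"
proof -
  have "compact (closure S)"
    using assms(4) by (simp add: compact_closure)
  moreover have "closure S \<subseteq> C"
    using assms(2,3) by (simp add: closure_minimal)
  ultimately have "bounded (T ` closure S)"
    using assms(1) by (intro compact_imp_bounded compact_continuous_image) (auto intro: continuous_on_subset)
  then show ?thesis
    by (rule bounded_subset) (intro image_mono closure_subset)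
qed

text \<open>The angle at the projection \<open>p\<close> between \<open>x - p\<close> and
  \<open>y - p\<close> is not acute, so the cross term in the expansion of the squared distance has
  the right sign.\<close>

lemma closest_point_pythagoras:
  fixes x y :: "'a::euclidean_space"
  assumes "convex S" "closed S" "y \<in> S"
  shows "(norm (closest_point S x - y))\<^sup>2 + (norm (closest_point S x - x))\<^sup>2 \<le> (norm (x - y))\<^sup>2"
proof -
  define p where "p = closest_point S x"
  have "(x - p) \<bullet> (y - p) \<le> 0"
    unfolding p_def by (rule closest_point_dot[OF assms])
  then show ?thesis
    unfolding p_def[symmetric] power2_norm_eq_inner
    by (simp add: inner_diff_left inner_diff_right inner_commute)
qed

text \<open>Once one term of the subsequence is within \<open>e\<close> of \<open>l\<close>,
  monotonicity keeps all later terms there.\<close>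

lemma antimono_dist_subsequence_limit:
  fixes x :: "nat \<Rightarrow> 'a::metric_space"
  assumes "antimono (\<lambda>k. dist (x k) l)" "strict_mono r" "(x \<circ> r) \<longlonglongrightarrow> l"
  shows "x \<longlonglongrightarrow> l"
proof (rule metric_LIMSEQ_I)
  fix e :: real assume "0 < e"
  then obtain N where "dist (x (r N)) l < e"
    using metric_LIMSEQ_D[OF assms(3)] by auto
  then have "\<forall>n\<ge>r N. dist (x n) l < e"
    using antimonoD[OF assms(1)] by (blast intro: le_less_trans)
  then show "\<exists>no. \<forall>n\<ge>no. dist (x n) l < e" ..
qed

section \<open>Separating halfspaces and the residual estimate\<close>

lemma VI_solutions_in_sep_halfspace:
  assumes "VI_solutions T C \<subseteq> dual_VI_solutions T C" "p \<in> VI_solutions T C"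
    and "y \<in> C" "w \<in> normal_cone C y"
  shows "p \<in> C \<inter> sep_halfspace T y w"
proof -
  \<comment> \<open>The inclusion of the solutions in the dual solutions enters here: it controls
    the \<open>T y\<close> part of the halfspace inequality, and the normal cone controls the
    \<open>w\<close> part.\<close>
  have p: "p \<in> C" "0 \<le> T y \<bullet> (y - p)"
    using assms by (auto simp: dual_VI_solutions_def)
  moreover have "w \<bullet> (p - y) \<le> 0"
    using assms(4) p(1) by (auto simp: normal_cone_def)
  ultimately show ?thesis
    by (simp add: sep_halfspace_def inner_add_left inner_diff_right)
qed

lemma closed_sep_halfspace: "closed (sep_halfspace T y w)"
proof -
  have "sep_halfspace T y w = {p. (T y + w) \<bullet> p \<le> (T y + w) \<bullet> y}"
    by (auto simp: sep_halfspace_def inner_diff_right)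
  then show ?thesis by (simp add: closed_halfspace_le)
qed

lemma convex_sep_halfspace: "convex (sep_halfspace T y w)"
proof -
  have "sep_halfspace T y w = {p. (T y + w) \<bullet> p \<le> (T y + w) \<bullet> y}"
    by (auto simp: sep_halfspace_def inner_diff_right)
  then show ?thesis by (simp add: convex_halfspace_le)
qed

text \<open>Acceptance bounds \<open>g \<bullet> (x - q)\<close> from below by a multiple of the
  squared residual. As \<open>y\<close> is on the far side of the hyperplane through
  \<open>q\<close>, the same quantity is at most \<open>g \<bullet> (x - y)\<close>, and
  Cauchy-Schwarz applies. In a run, \<open>y\<close> is the next iterate.\<close>

lemma stepsize_residual_le:
  assumes "closed C" "convex C" "x \<in> C" "0 < b" "b \<le> B" "0 < \<delta>" "0 < a"
    and "\<not> backtrack T C \<delta> x u b a w"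
    and "y \<in> sep_halfspace T (trial_point T C x u b a) w"
  shows "a * (norm (x - trial_z T C x u b a))\<^sup>2
    \<le> B / \<delta> * (norm (T (trial_point T C x u b a) + w) * norm (y - x))"
proof -
  define z where "z = trial_z T C x u b a"
  define q where "q = trial_point T C x u b a"
  define g where "g = T q + w"
  define s where "s = (T x + a *\<^sub>R u) \<bullet> (x - z)"
  have dec: "(norm (x - z))\<^sup>2 \<le> b * s"
    using trial_z_decrease[OF assms(1-3)] unfolding z_def s_def by blast
  \<comment> \<open>The sign of \<open>s\<close> allows \<open>b\<close> to be replaced by its upper
    bound \<open>B\<close> below.\<close>
  then have "0 \<le> s"
    using \<open>0 < b\<close> by (smt (verit) mult_pos_neg zero_le_power2)
  have xq: "x - q = a *\<^sub>R (x - z)"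
    unfolding q_def z_def trial_point_def by (simp add: algebra_simps)
  have "\<delta> * s \<le> g \<bullet> (x - z)"
    using assms(8) by (simp add: backtrack_def g_def s_def z_def q_def)
  then have "a * (\<delta> * s) \<le> g \<bullet> (x - q)"
    using \<open>0 < a\<close> by (simp add: xq)
  also have "\<dots> = g \<bullet> (x - y) + g \<bullet> (y - q)"
    by (simp add: inner_diff_right)
  also have "\<dots> \<le> g \<bullet> (x - y)"
    using assms(9) by (simp add: sep_halfspace_def g_def q_def)
  also have "\<dots> \<le> norm g * norm (y - x)"
    using norm_cauchy_schwarz[of g "x - y"] by (simp add: norm_minus_commute)
  finally have as: "a * (\<delta> * s) \<le> norm g * norm (y - x)" .
  have "a * (norm (x - z))\<^sup>2 \<le> a * (B * s)"
    using dec \<open>0 < a\<close> \<open>b \<le> B\<close> \<open>0 \<le> s\<close>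
    by (intro mult_left_mono) (auto intro: order_trans mult_right_mono)
  also have "\<dots> = B / \<delta> * (a * (\<delta> * s))"
    using \<open>0 < \<delta>\<close> by simp
  also have "\<dots> \<le> B / \<delta> * (norm g * norm (y - x))"
    using as assms(4-6) by (intro mult_left_mono) auto
  finally show ?thesis
    unfolding z_def g_def q_def .
qed

text \<open>As \<open>a\<close> vanishes, the trial points also tend to \<open>x'\<close>, so both
  sides of the rejection inequality have limits featuring \<open>T x'\<close>. The factor
  \<open>\<delta> < 1\<close> then forces \<open>T x' \<bullet> (x' - z') \<le> 0\<close>, and the
  projection estimate with \<open>a = 0\<close> yields \<open>z' = x'\<close>.\<close>

lemma rejected_limit_VI:
  assumes C: "closed C" "convex C" "continuous_on C T" and "\<delta> < 1" "0 < b'"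
    and xC: "\<And>k. x k \<in> C" and "u' \<in> normal_cone C x'"
    and lim: "x \<longlonglongrightarrow> x'" "u \<longlonglongrightarrow> u'" "w \<longlonglongrightarrow> w'" "b \<longlonglongrightarrow> b'" "a \<longlonglongrightarrow> 0"
    and ev: "\<forall>\<^sub>F k in sequentially. 0 \<le> a k \<and> a k \<le> 1
      \<and> w k \<in> normal_cone C (trial_point T C (x k) (u k) (b k) (a k))
      \<and> backtrack T C \<delta> (x k) (u k) (b k) (a k) (w k)"
  shows "x' \<in> VI_solutions T C"
proof -
  have x'C: "x' \<in> C"
    using xC closed_sequentially[OF C(1) _ lim(1)] by auto
  then have "C \<noteq> {}" by auto
  define z where "z k = trial_z T C (x k) (u k) (b k) (a k)" for k
  define z' where "z' = trial_z T C x' u' b' 0"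
  define q where "q k = trial_point T C (x k) (u k) (b k) (a k)" for k
  have z: "z \<longlonglongrightarrow> z'"
    unfolding z_def z'_def by (rule tendsto_trial_z[OF C xC lim(1,2,4,5)])
  have "q \<longlonglongrightarrow> 0 *\<^sub>R z' + (1 - 0) *\<^sub>R x'"
    unfolding q_def trial_point_def z_def[symmetric] by (intro tendsto_intros lim z)
  then have q: "q \<longlonglongrightarrow> x'" by simp
  have "\<forall>\<^sub>F k in sequentially. q k \<in> C"
    using ev by eventually_elim (auto simp: q_def intro: trial_point_in[OF C(1,2) xC])
  then have Tq: "(\<lambda>k. T (q k)) \<longlonglongrightarrow> T x'"
    by (rule continuous_on_tendsto_compose[OF C(3) q x'C])
  have Tx: "(\<lambda>k. T (x k)) \<longlonglongrightarrow> T x'"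
    by (rule continuous_on_tendsto_compose[OF C(3) lim(1) x'C]) (simp add: xC)
  obtain N where N: "\<And>k. N \<le> k \<Longrightarrow> w k \<in> normal_cone C (q k)
      \<and> backtrack T C \<delta> (x k) (u k) (b k) (a k) (w k)"
    using ev by (auto simp: eventually_sequentially q_def)
  \<comment> \<open>Membership holds only from \<open>N\<close> on, so the closed-graph property of
    the normal cone is applied to shifted sequences.\<close>
  have w': "w' \<in> normal_cone C x'"
  proof (rule normal_cone_limit)
    show "w (k + N) \<in> normal_cone C (q (k + N))" for k
      using N by simp
  qed (use lim q in \<open>auto intro: LIMSEQ_ignore_initial_segment\<close>)
  have "(T x' + w') \<bullet> (x' - z') \<le> \<delta> * ((T x' + 0 *\<^sub>R u') \<bullet> (x' - z'))"
  proof (rule tendsto_le[OF sequentially_bot])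
    show "(\<lambda>k. (T (q k) + w k) \<bullet> (x k - z k)) \<longlonglongrightarrow> (T x' + w') \<bullet> (x' - z')"
      by (intro tendsto_intros Tq lim z)
    show "(\<lambda>k. \<delta> * ((T (x k) + a k *\<^sub>R u k) \<bullet> (x k - z k)))
        \<longlonglongrightarrow> \<delta> * ((T x' + 0 *\<^sub>R u') \<bullet> (x' - z'))"
      by (intro tendsto_intros Tx lim z)
    show "\<forall>\<^sub>F k in sequentially. (T (q k) + w k) \<bullet> (x k - z k)
        \<le> \<delta> * ((T (x k) + a k *\<^sub>R u k) \<bullet> (x k - z k))"
      using ev by eventually_elim (auto simp: backtrack_def q_def z_def)
  qed
  moreover have "w' \<bullet> (z' - x') \<le> 0"
    using w' trial_z_in[OF C(1) \<open>C \<noteq> {}\<close>] unfolding normal_cone_def z'_def by blast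
  ultimately have "(1 - \<delta>) * (T x' \<bullet> (x' - z')) \<le> 0"
    by (simp add: inner_add_left inner_diff_right algebra_simps)
  then have "T x' \<bullet> (x' - z') \<le> 0"
    using \<open>\<delta> < 1\<close> by (simp add: mult_le_0_iff)
  then have "b' * (T x' \<bullet> (x' - z')) \<le> 0"
    using \<open>0 < b'\<close> by (simp add: mult_le_0_iff)
  moreover have "(norm (x' - z'))\<^sup>2 \<le> b' * (T x' \<bullet> (x' - z'))"
    using trial_z_decrease[OF C(1,2) x'C, of T u' b' 0] by (simp add: z'_def)
  ultimately have "(norm (x' - z'))\<^sup>2 \<le> 0"
    by linarith
  then have "trial_z T C x' u' b' 0 = x'"
    by (simp add: z'_def)
  then show ?thesis
    by (intro trial_z_fixed_point_VI[OF C(1,2) x'C \<open>0 < b'\<close> _ assms(7)]) auto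
qed

theorem proposition4p9:
  fixes T :: "real ^ 'n \<Rightarrow> real ^ 'n"
    and C :: "(real ^ 'n) set"
    and \<beta> :: "nat \<Rightarrow> real"
    and \<beta>lo \<beta>hi \<delta> \<theta> M :: real
    and x u z v :: "nat \<Rightarrow> real ^ 'n"
    and \<alpha> :: "nat \<Rightarrow> real"
  assumes "C \<noteq> {}" and "closed C" and "convex C"
    and "0 < \<beta>lo" and "\<beta>lo \<le> \<beta>hi" and "\<And>k. \<beta> k \<in> {\<beta>lo..\<beta>hi}"
    and "\<delta> \<in> {0<..<1}" and "\<theta> \<in> {0<..<1}" and "M > 0"
    and "continuous_on C T"
    and "VI_solutions T C \<noteq> {}"
    and "VI_solutions T C \<subseteq> dual_VI_solutions T C"
    and "conceptual_algorithm_F T C \<beta> \<delta> \<theta> M (variant_F2 T C) x u \<alpha> z v"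
    and "\<And>k. x k \<notin> VI_solutions T C"
  shows "\<exists>xs \<in> VI_solutions T C. x \<longlonglongrightarrow> xs"
proof -
  note C = \<open>closed C\<close> \<open>convex C\<close> \<open>continuous_on C T\<close>
  have \<delta>: "0 < \<delta>" "\<delta> < 1" and \<theta>: "0 < \<theta>" "\<theta> < 1" "\<theta> \<in> {0<..<1}"
    using assms(7,8) by auto
  have \<beta>: "\<beta>lo \<le> \<beta> k" "\<beta> k \<le> \<beta>hi" "0 < \<beta> k" for k
    using assms(6)[of k] assms(4) by auto
  note alg = assms(13)[unfolded conceptual_algorithm_F_def linesearch_F_output_def]
  define q where "q k = trial_point T C (x k) (u k) (\<beta> k) (\<alpha> k)" for k
  define D where "D k = C \<inter> sep_halfspace T (q k) (v k)" for k
  have reach: "linesearch_F_reaches T C \<delta> \<theta> M (x k) (u k) (\<beta> k) (\<alpha> k) (v k)"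
    and accept: "\<not> backtrack T C \<delta> (x k) (u k) (\<beta> k) (\<alpha> k) (v k)"
    and z: "z k = trial_z T C (x k) (u k) (\<beta> k) (\<alpha> k)"
    and u: "u k \<in> normal_cone C (x k)" "norm (u k) \<le> M" for k
    using alg by blast+
  have next_x: "x (Suc k) = closest_point (D k) (x k)" for k
  proof -
    have "q k = \<alpha> k *\<^sub>R z k + (1 - \<alpha> k) *\<^sub>R x k"
      by (simp add: q_def trial_point_def z)
    then show ?thesis
      using alg by (simp add: variant_F2_def D_def)
  qed
  have \<alpha>: "0 < \<alpha> k" "\<alpha> k \<le> 1" and v: "v k \<in> normal_cone C (q k)" "norm (v k) \<le> M" for k
    using linesearch_F_reaches_bounds[OF reach[of k] \<theta>(3)] unfolding q_def by auto
  have D: "closed (D k)" "convex (D k)" for k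
    unfolding D_def
    by (intro closed_Int convex_Int C closed_sep_halfspace convex_sep_halfspace)+
  \<comment> \<open>This makes \<open>D k\<close> nonempty, so that the projection onto it is
    meaningful. The premise \<open>x k \<in> C\<close> is discharged only by the induction for
    \<open>xC\<close>, which itself relies on this fact.\<close>
  have SD: "p \<in> D k" if "x k \<in> C" "p \<in> VI_solutions T C" for p k
    unfolding D_def
    using that trial_point_in[OF C(1,2) that(1), of "\<alpha> k"] less_imp_le[OF \<alpha>(1)[of k]] \<alpha>(2)[of k] v(1)[of k]
    by (intro VI_solutions_in_sep_halfspace[OF assms(12)]) (auto simp: q_def)
  have xD: "x (Suc k) \<in> D k" if "x k \<in> C" for k
    unfolding next_x using SD[OF that] assms(11) by (intro closest_point_in_set D) auto
  have xC: "x k \<in> C" for k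
  proof (induction k)
    case (Suc k)
    then show ?case using xD[of k] by (simp add: D_def)
  qed (use alg in blast)

  \<comment> \<open>Fejer monotonicity and vanishing steps\<close>
  have fejer: "(norm (x (Suc k) - p))\<^sup>2 + (norm (x (Suc k) - x k))\<^sup>2 \<le> (norm (x k - p))\<^sup>2"
    if "p \<in> VI_solutions T C" for p k
    unfolding next_x by (rule closest_point_pythagoras[OF D(2,1) SD[OF xC that]])
  have anti: "antimono (\<lambda>k. dist (x k) p)" if "p \<in> VI_solutions T C" for p
  proof (rule decseq_SucI)
    fix k
    have "(norm (x (Suc k) - p))\<^sup>2 \<le> (norm (x k - p))\<^sup>2"
      using fejer[OF that, of k] zero_le_power2[of "norm (x (Suc k) - x k)"] by linarith
    then show "dist (x (Suc k)) p \<le> dist (x k) p"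
      by (simp add: dist_norm)
  qed
  obtain p where p: "p \<in> VI_solutions T C" using assms(11) by auto
  have bdd_x: "bounded (range x)"
  proof (rule bounded_subset[OF bounded_cball])
    show "range x \<subseteq> cball p (dist (x 0) p)"
      using antimonoD[OF anti[OF p], of 0] by (auto simp: dist_commute)
  qed
  have step0: "(\<lambda>k. norm (x (Suc k) - x k)) \<longlonglongrightarrow> 0"
  proof -
    \<comment> \<open>The squared distances to \<open>p\<close> decrease and are bounded below, so
      their consecutive differences tend to zero; by \<open>fejer\<close> these dominate the squared
      steps.\<close>
    have "decseq (\<lambda>k. (dist (x k) p)\<^sup>2)"
      using anti[OF p] by (auto simp: antimono_def intro: power_mono)
    then obtain L where "(\<lambda>k. (dist (x k) p)\<^sup>2) \<longlonglongrightarrow> L"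
      using decseq_convergent[of _ 0] by (metis zero_le_power2)
    then have "(\<lambda>k. (dist (x k) p)\<^sup>2 - (dist (x (Suc k)) p)\<^sup>2) \<longlonglongrightarrow> L - L"
      by (intro tendsto_diff LIMSEQ_Suc)
    then have "(\<lambda>k. (dist (x k) p)\<^sup>2 - (dist (x (Suc k)) p)\<^sup>2) \<longlonglongrightarrow> 0"
      by simp
    then have "(\<lambda>k. (norm (x (Suc k) - x k))\<^sup>2) \<longlonglongrightarrow> 0"
      by (rule tendsto_sandwich[rotated 2, OF tendsto_const])
        (use fejer[OF p] in \<open>auto simp: dist_norm le_diff_eq add.commute\<close>)
    then show ?thesis by (simp add: tendsto_power_zero)
  qed

  \<comment> \<open>Boundedness of the auxiliary sequences\<close>
  obtain X where X: "\<And>k. norm (x k) \<le> X"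
    using bdd_x by (auto simp: bounded_iff)
  obtain Y where Y: "\<And>k. norm (T (x k)) \<le> Y"
    using bounded_image_continuous_closed[OF C(3,1) _ bdd_x] xC by (auto simp: bounded_iff)
  have z_bound: "norm (z k) \<le> X + \<beta>hi * (Y + M)" for k
  proof -
    have "norm (\<alpha> k *\<^sub>R u k) \<le> 1 * M"
      unfolding norm_scaleR using \<alpha>[of k] u(2)[of k] by (intro mult_mono) auto
    then have g: "norm (T (x k) + \<alpha> k *\<^sub>R u k) \<le> Y + M"
      using Y[of k] norm_triangle_ineq[of "T (x k)" "\<alpha> k *\<^sub>R u k"] by linarith
    have "norm (z k - x k) \<le> \<beta> k * norm (T (x k) + \<alpha> k *\<^sub>R u k)"
      unfolding z using norm_trial_z_diff_le[OF C(1,2) xC] \<beta>(3)[of k] by (simp add: less_imp_le)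
    also have "\<dots> \<le> \<beta>hi * (Y + M)"
      using g \<beta>(2,3)[of k] by (intro mult_mono) auto
    finally have "norm (z k - x k) \<le> \<beta>hi * (Y + M)" .
    then show ?thesis
      using X[of k] norm_triangle_sub[of "z k" "x k"] by linarith
  qed
  have q_bound: "norm (q k) \<le> (X + \<beta>hi * (Y + M)) + X" for k
  proof -
    have "norm (q k) \<le> norm (\<alpha> k *\<^sub>R z k) + norm ((1 - \<alpha> k) *\<^sub>R x k)"
      unfolding q_def trial_point_def z[symmetric] by (rule norm_triangle_ineq)
    also have "\<dots> \<le> 1 * (X + \<beta>hi * (Y + M)) + 1 * X"
      unfolding norm_scaleR using \<alpha>[of k] z_bound[of k] X[of k]
      by (intro add_mono mult_mono) auto
    finally show ?thesis by simp
  qed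
  \<comment> \<open>Continuity of \<open>T\<close> is available on \<open>C\<close> only, so
    bounding \<open>T (q k)\<close> requires \<open>q k\<close> to stay there.\<close>
  have qC: "q k \<in> C" for k
    unfolding q_def using \<alpha>[of k] by (intro trial_point_in[OF C(1,2) xC]) auto
  have "bounded (range q)"
    using q_bound by (auto simp: bounded_iff)
  then obtain G where G: "\<And>k. norm (T (q k)) \<le> G"
    using bounded_image_continuous_closed[OF C(3,1), of "range q"] qC by (auto simp: bounded_iff)

  \<comment> \<open>Vanishing residuals\<close>
  have residual0: "(\<lambda>k. \<alpha> k * (norm (x k - z k))\<^sup>2) \<longlonglongrightarrow> 0"
  proof (rule tendsto_sandwich[OF _ _ tendsto_const])
    show "(\<lambda>k. \<beta>hi / \<delta> * ((G + M) * norm (x (Suc k) - x k))) \<longlonglongrightarrow> 0"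
      by (intro tendsto_mult_right_zero step0)
    have "\<alpha> k * (norm (x k - z k))\<^sup>2 \<le> \<beta>hi / \<delta> * ((G + M) * norm (x (Suc k) - x k))" for k
    proof -
      \<comment> \<open>The next iterate is projected onto \<open>D k\<close>, so it can serve as
        \<open>y\<close> in the residual estimate.\<close>
      have "x (Suc k) \<in> sep_halfspace T (q k) (v k)"
        using xD[OF xC] by (simp add: D_def)
      then have "\<alpha> k * (norm (x k - z k))\<^sup>2
          \<le> \<beta>hi / \<delta> * (norm (T (q k) + v k) * norm (x (Suc k) - x k))"
        unfolding z q_def
        by (intro stepsize_residual_le[OF C(1,2) xC \<beta>(3,2) \<delta>(1) \<alpha>(1) accept])
      also have "\<dots> \<le> \<beta>hi / \<delta> * ((G + M) * norm (x (Suc k) - x k))"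
        using G[of k] v(2)[of k] norm_triangle_ineq[of "T (q k)" "v k"] \<delta>(1) assms(4,5)
        by (intro mult_left_mono mult_right_mono) auto
      finally show ?thesis .
    qed
    then show "\<forall>\<^sub>F k in sequentially. \<alpha> k * (norm (x k - z k))\<^sup>2
        \<le> \<beta>hi / \<delta> * ((G + M) * norm (x (Suc k) - x k))" by simp
  qed (use less_imp_le[OF \<alpha>(1)] in auto)
  \<comment> \<open>The norm bound stands outside the implication so that \<open>w\<close> is
    bounded over all \<open>k\<close>. If \<open>\<alpha> k = 1\<close>, no trial was rejected and 0
    is a filler value.\<close>
  have "\<exists>w. norm w \<le> M \<and> (\<alpha> k < 1 \<longrightarrow> \<alpha> k / \<theta> \<le> 1
      \<and> w \<in> normal_cone C (trial_point T C (x k) (u k) (\<beta> k) (\<alpha> k / \<theta>))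
      \<and> backtrack T C \<delta> (x k) (u k) (\<beta> k) (\<alpha> k / \<theta>) w)" for k
  proof (cases "\<alpha> k < 1")
    case True
    then show ?thesis
      using linesearch_F_reaches_rejected[OF reach \<theta>(3)] by blast
  next
    case False
    then show ?thesis using \<open>M > 0\<close> by (intro exI[of _ 0]) auto
  qed
  then obtain w where w: "\<And>k. norm (w k) \<le> M"
    and rejected: "\<And>k. \<alpha> k < 1 \<Longrightarrow> \<alpha> k / \<theta> \<le> 1
      \<and> w k \<in> normal_cone C (trial_point T C (x k) (u k) (\<beta> k) (\<alpha> k / \<theta>))
      \<and> backtrack T C \<delta> (x k) (u k) (\<beta> k) (\<alpha> k / \<theta>) (w k)"
    by metis

  \<comment> \<open>A common convergent subsequence\<close>
  define s where "s k = (x k, u k, w k, \<beta> k, \<alpha> k)" for k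
  have "bounded (range s)"
  proof (rule bounded_subset)
    show "bounded (range x \<times> cball 0 M \<times> cball 0 M \<times> {\<beta>lo..\<beta>hi} \<times> {0..1::real})"
      by (intro bounded_Times bdd_x bounded_cball bounded_closed_interval)
    show "range s \<subseteq> range x \<times> cball 0 M \<times> cball 0 M \<times> {\<beta>lo..\<beta>hi} \<times> {0..1::real}"
      using u w \<beta> \<alpha> by (auto simp: s_def less_imp_le)
  qed
  then obtain l r where r: "strict_mono r" and "(s \<circ> r) \<longlonglongrightarrow> l"
    using bounded_imp_convergent_subsequence by blast
  moreover obtain x' u' w' b' a' where "l = (x', u', w', b', a')"
    by (cases l) auto
  ultimately have lim_s: "(\<lambda>k. s (r k)) \<longlonglongrightarrow> (x', u', w', b', a')"
    by (simp add: o_def)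
  note L1 = tendsto_snd[OF lim_s] note L2 = tendsto_snd[OF L1] note L3 = tendsto_snd[OF L2]
  have lim: "(\<lambda>k. x (r k)) \<longlonglongrightarrow> x'" "(\<lambda>k. u (r k)) \<longlonglongrightarrow> u'" "(\<lambda>k. w (r k)) \<longlonglongrightarrow> w'"
    "(\<lambda>k. \<beta> (r k)) \<longlonglongrightarrow> b'" "(\<lambda>k. \<alpha> (r k)) \<longlonglongrightarrow> a'"
    using tendsto_fst[OF lim_s] tendsto_fst[OF L1] tendsto_fst[OF L2]
      tendsto_fst[OF L3] tendsto_snd[OF L3] by (simp_all add: s_def)
  have x'C: "x' \<in> C"
    using closed_sequentially[OF C(1) _ lim(1)] xC by blast
  have u': "u' \<in> normal_cone C x'"
    by (rule normal_cone_limit[OF _ lim(1,2)]) (rule u)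
  \<comment> \<open>The uniform lower bound survives the limit; positivity of each
    \<open>\<beta> k\<close> alone would only give \<open>0 \<le> b'\<close>.\<close>
  have "\<beta>lo \<le> b'"
    using LIMSEQ_le_const[OF lim(4)] \<beta>(1) by blast
  then have b': "0 < b'" using assms(4) by linarith
  have a': "0 \<le> a'"
    using LIMSEQ_le_const[OF lim(5)] less_imp_le[OF \<alpha>(1)] by blast

  \<comment> \<open>The cluster point is a solution\<close>
  have "x' \<in> VI_solutions T C"
  proof (cases "a' = 0")
    case False
    have "(\<lambda>k. z (r k)) \<longlonglongrightarrow> trial_z T C x' u' b' a'"
      unfolding z by (rule tendsto_trial_z[OF C xC lim(1,2,4,5)])
    then have "(\<lambda>k. \<alpha> (r k) * (norm (x (r k) - z (r k)))\<^sup>2)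
        \<longlonglongrightarrow> a' * (norm (x' - trial_z T C x' u' b' a'))\<^sup>2"
      by (intro tendsto_intros lim)
    moreover have "(\<lambda>k. \<alpha> (r k) * (norm (x (r k) - z (r k)))\<^sup>2) \<longlonglongrightarrow> 0"
      using LIMSEQ_subseq_LIMSEQ[OF residual0 r] by (simp add: o_def)
    ultimately have "a' * (norm (x' - trial_z T C x' u' b' a'))\<^sup>2 = 0"
      by (rule LIMSEQ_unique)
    then have "trial_z T C x' u' b' a' = x'"
      using False by simp
    then show ?thesis
      by (rule trial_z_fixed_point_VI[OF C(1,2) x'C b' a' u'])
  next
    case True
    have lim_a: "(\<lambda>k. \<alpha> (r k) / \<theta>) \<longlonglongrightarrow> 0"
      using tendsto_divide[OF lim(5) tendsto_const[of \<theta>]] \<theta>(1) True by simp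
    \<comment> \<open>Stepsizes tending to zero are eventually below 1, so a rejected trial really
      exists there and \<open>w (r k)\<close> is its normal vector.\<close>
    have "\<forall>\<^sub>F k in sequentially. \<alpha> (r k) < 1"
      using order_tendstoD(2)[OF lim(5), of 1] True by simp
    then have "\<forall>\<^sub>F k in sequentially. 0 \<le> \<alpha> (r k) / \<theta> \<and> \<alpha> (r k) / \<theta> \<le> 1
      \<and> w (r k) \<in> normal_cone C (trial_point T C (x (r k)) (u (r k)) (\<beta> (r k)) (\<alpha> (r k) / \<theta>))
      \<and> backtrack T C \<delta> (x (r k)) (u (r k)) (\<beta> (r k)) (\<alpha> (r k) / \<theta>) (w (r k))"
      by eventually_elim (use rejected less_imp_le[OF \<alpha>(1)] \<theta>(1) in auto)
    then show ?thesis
      by (rule rejected_limit_VI[OF C \<delta>(2) b' xC u' lim(1-4) lim_a])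
  qed
  \<comment> \<open>Fejer monotonicity is now used with the cluster point itself as the
    solution.\<close>
  moreover from this have "x \<longlonglongrightarrow> x'"
    using lim(1) by (intro antimono_dist_subsequence_limit[OF anti r]) (auto simp: o_def)
  ultimately show ?thesis by blast
qed

end
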